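(* Let $a<0<b$ and let $(X,g)$ be the surface of revolution $$X=\mathbb{R}\times S^1,\qquad g=dr^2+f(r)^2\,d\theta^2,\qquad f(r)=\begin{cases}1+ar & \text{if } r\le 0,\\ e^{-br} & \text{if } r>0.\end{cases}$$ If $a+b=0$, then $(X,g)$ has a nontrapping geodesic flow.
   Context: Here $S^1=\mathbb{R}/2\pi\mathbb{Z}$ with coordinate $\theta$. When $a+b=0$ one has $f\in C^{1,1}$, so the (nonconstant) geodesics are well defined as the unique solutions of the geodesic equations of $g$. The geodesic flow is called nontrapping if every maximally extended (nonconstant) geodesic is unbounded in $X$. *)

theory Defs
  imports "HOL-Analysis.Analysis"
begin

quotient_type circle = real / "\<lambda>s t :: real. \<exists>k::int. s = t + 2 * pi * of_int k"
proof (rule equivpI)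
  show "reflp (\<lambda>s t :: real. \<exists>k::int. s = t + 2 * pi * of_int k)"
    by (rule reflpI, rule exI[of _ 0]) simp
  show "symp (\<lambda>s t :: real. \<exists>k::int. s = t + 2 * pi * of_int k)"
  proof (rule sympI)
    fix s t :: real
    assume "\<exists>k::int. s = t + 2 * pi * of_int k"
    then obtain k :: int where "s = t + 2 * pi * of_int k" ..
    then show "\<exists>k::int. t = s + 2 * pi * of_int k"
      by (intro exI[of _ "- k"]) simp
  qed
  show "transp (\<lambda>s t :: real. \<exists>k::int. s = t + 2 * pi * of_int k)"
  proof (rule transpI)
    fix s t u :: real
    assume "\<exists>k::int. s = t + 2 * pi * of_int k" "\<exists>k::int. t = u + 2 * pi * of_int k"
    then obtain k l :: int where "s = t + 2 * pi * of_int k" "t = u + 2 * pi * of_int l"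
      by blast
    then show "\<exists>k::int. s = u + 2 * pi * of_int k"
      by (intro exI[of _ "k + l"]) (simp add: algebra_simps)
  qed
qed

type_synonym cylinder = "real \<times> circle"

text \<open>
  The universal covering of the cylinder, from the coordinates (r, theta). Its local inverses are
  the coordinate charts. Every curve in the cylinder that is parametrized by an interval is the
  projection of a curve in the plane, so regularity of curves, their velocities and the geodesic
  equations are all expressed on lifts; none of them depends on the choice of the lift.
\<close>

definition cyl_proj :: "real ^ 2 \<Rightarrow> cylinder" where
  "cyl_proj x = (x $ 1, abs_circle (x $ 2))"

text \<open>
  A Riemannian metric on the cylinder is given by its matrix with respect to the global frame
  of the coordinate vector fields of r (index 1) and theta (index 2).
\<close>

type_synonym metric = "cylinder \<Rightarrow> real ^ 2 ^ 2"

definition revolution_metric :: "(real \<Rightarrow> real) \<Rightarrow> metric" where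
  "revolution_metric f p = vector [vector [1, 0], vector [0, (f (fst p))\<^sup>2]]"

definition profile :: "real \<Rightarrow> real \<Rightarrow> real \<Rightarrow> real" where
  "profile a b r = (if r \<le> 0 then 1 + a * r else exp (- b * r))"

text \<open>
  The derivatives below are meaningful only where the metric coefficients are differentiable. For
  the metric of revolution with the above profile this is the case everywhere iff a + b = 0.
\<close>

definition partial_deriv :: "2 \<Rightarrow> (real ^ 2 \<Rightarrow> real) \<Rightarrow> real ^ 2 \<Rightarrow> real" where
  "partial_deriv i h x = frechet_derivative h (at x) (axis i 1)"

definition christoffel :: "metric \<Rightarrow> 2 \<Rightarrow> 2 \<Rightarrow> 2 \<Rightarrow> real ^ 2 \<Rightarrow> real" where
  "christoffel g k i j x =
    (let G = (\<lambda>y. g (cyl_proj y)) in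
      1 / 2 * (\<Sum>l\<in>UNIV. matrix_inv (G x) $ k $ l *
        (partial_deriv i (\<lambda>y. G y $ j $ l) x + partial_deriv j (\<lambda>y. G y $ i $ l) x
          - partial_deriv l (\<lambda>y. G y $ i $ j) x)))"

definition geodesic_on :: "metric \<Rightarrow> real set \<Rightarrow> (real \<Rightarrow> cylinder) \<Rightarrow> bool" where
  "geodesic_on g I \<gamma> \<longleftrightarrow>
    open I \<and> is_interval I \<and> I \<noteq> {} \<and>
    (\<exists>x v. \<forall>t\<in>I. \<gamma> t = cyl_proj (x t) \<and>
      (x has_vector_derivative v t) (at t) \<and>
      (v has_vector_derivative
        (\<chi> k. - (\<Sum>i\<in>UNIV. \<Sum>j\<in>UNIV. christoffel g k i j (x t) * v t $ i * v t $ j))) (at t))"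

definition maximal_geodesic_on :: "metric \<Rightarrow> real set \<Rightarrow> (real \<Rightarrow> cylinder) \<Rightarrow> bool" where
  "maximal_geodesic_on g I \<gamma> \<longleftrightarrow>
    geodesic_on g I \<gamma> \<and>
    (\<forall>J \<delta>. geodesic_on g J \<delta> \<and> I \<subseteq> J \<and> (\<forall>t\<in>I. \<delta> t = \<gamma> t) \<longrightarrow> J = I)"

text \<open>
  The length is a nonnegative Lebesgue integral with values in [0, infinity]:
  \<^const>\<open>piecewise_C1_differentiable_on\<close> allows the velocity to be unbounded near the
  finitely many exceptional points, so a curve may have infinite length.
\<close>

definition curve_length :: "metric \<Rightarrow> (real \<Rightarrow> real ^ 2) \<Rightarrow> ennreal" where
  "curve_length g x = (\<integral>\<^sup>+t\<in>{0..1}.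
    (let v = vector_derivative x (at t) in ennreal (sqrt (v \<bullet> (g (cyl_proj (x t)) *v v)))) \<partial>lborel)"

definition riem_dist :: "metric \<Rightarrow> cylinder \<Rightarrow> cylinder \<Rightarrow> ennreal" where
  "riem_dist g p q =
    (INF x \<in> {x. x piecewise_C1_differentiable_on {0..1} \<and>
                 cyl_proj (x 0) = p \<and> cyl_proj (x 1) = q}. curve_length g x)"

definition riem_bounded :: "metric \<Rightarrow> cylinder set \<Rightarrow> bool" where
  "riem_bounded g S \<longleftrightarrow> (\<exists>p C. \<forall>q\<in>S. riem_dist g p q \<le> ennreal C)"

definition nontrapping :: "metric \<Rightarrow> bool" where
  "nontrapping g \<longleftrightarrow>
    (\<forall>I \<gamma>. maximal_geodesic_on g I \<gamma> \<and> \<not> \<gamma> constant_on I \<longrightarrow> \<not> riem_bounded g (\<gamma> ` I))"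

end

theory Submission
  imports Defs
begin

text \<open>
  Since \<open>a = - b\<close>, the profile \<open>f\<close> is \<open>C\<^sup>1\<close>, positive and strictly decreasing. Along a geodesic the
  squared speed \<open>E\<close> and Clairaut's integral \<open>L = f\<^sup>2 \<theta>'\<close> are conserved, and \<open>r'' = L\<^sup>2 f' / f\<^sup>3\<close>. If \<open>r\<close>
  stayed bounded for all positive times, then either \<open>L = 0\<close> and \<open>r\<close> is affine in time, or \<open>r''\<close> is
  bounded above by a negative constant although \<open>r'\<close> is bounded; both are impossible. If instead the
  geodesic ends at a finite time \<open>T\<close> while \<open>r\<close> is bounded, position and velocity converge at \<open>T\<close>, and an
  explicit geodesic of the flat cone \<open>r \<le> 0\<close> or of the hyperbolic cusp \<open>r \<ge> 0\<close> continues it beyond \<open>T\<close>,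
  against maximality. Boundedness for the Riemannian distance bounds \<open>r\<close> because
  \<open>|r (q) - r (p)| \<le> d (p, q)\<close>.
\<close>

subsection \<open>Calculus\<close>

text \<open>On a compact interval around \<open>t\<close> inside \<open>J\<close>, the fundamental
  theorem of calculus tolerates the single point \<open>c\<close>, so \<open>F\<close> is there a
  constant plus the integral of the continuous \<open>G\<close>, and is differentiable at
  \<open>c\<close> too. It serves for the seam \<open>r = 0\<close> of the profile and for the time
  at which two solutions are glued.\<close>

lemma has_vector_derivative_at_exceptional_point:
  fixes F G :: "real \<Rightarrow> 'a::banach"
  assumes "open J" "continuous_on J F" "continuous_on J G"
    and "\<And>t. t \<in> J - {c} \<Longrightarrow> (F has_vector_derivative G t) (at t)"
    and "t \<in> J"
  shows "(F has_vector_derivative G t) (at t)"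
proof -
  obtain e where e: "e > 0" "cball t e \<subseteq> J"
    using assms(1,5) open_contains_cball by blast
  define l where "l = t - e"
  define u where "u = t + e"
  have J: "{l..u} \<subseteq> J" and t: "l < t" "t < u"
    using e by (auto simp: l_def u_def cball_eq_atLeastAtMost)
  have G: "continuous_on {l..u} G"
    using assms(3) J continuous_on_subset by blast
  have eq: "F s = F l + integral {l..s} G" if "s \<in> {l..u}" for s
  proof -
    have "(G has_integral (F s - F l)) {l..s}"
    proof (rule fundamental_theorem_of_calculus_interior_strong[of "{c}"])
      show "continuous_on {l..s} F"
        using assms(2) J that continuous_on_subset
        by (metis atLeastatMost_subset_iff atLeastAtMost_iff order.trans order_refl)
      show "(F has_vector_derivative G x) (at x)" if "x \<in> {l<..<s} - {c}" for x
        using J that \<open>s \<in> {l..u}\<close> by (intro assms(4)) auto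
    qed (use that in auto)
    then show ?thesis
      by (simp add: integral_unique)
  qed
  have "((\<lambda>s. F l + integral {l..s} G) has_vector_derivative (0 + G t)) (at t within {l..u})"
    by (intro has_vector_derivative_add has_vector_derivative_const integral_has_vector_derivative G)
      (use t in auto)
  then have "(F has_vector_derivative G t) (at t within {l..u})"
    unfolding add_0 by (rule has_vector_derivative_transform[rotated 2])
      (use eq t in \<open>simp_all only: atLeastAtMost_iff less_imp_le\<close>)
  then show ?thesis
    using t by (simp add: at_within_Icc_at)
qed

text \<open>A bounded derivative makes \<open>F\<close> Lipschitz, hence uniformly continuous, so it
  extends continuously to the endpoint \<open>T\<close>.\<close>

lemma bounded_derivative_imp_limit_at_left:
  fixes F F' :: "real \<Rightarrow> real"
  assumes "t0 < T" and "\<And>t. t \<in> {t0<..<T} \<Longrightarrow> (F has_real_derivative F' t) (at t)"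
    and "\<And>t. t \<in> {t0<..<T} \<Longrightarrow> \<bar>F' t\<bar> \<le> K"
  obtains l where "(F \<longlongrightarrow> l) (at_left T)"
proof -
  have "K \<ge> 0"
    using assms(3)[of "(t0 + T) / 2"] assms(1) by auto
  have "K-lipschitz_on {t0<..<T} F"
    using assms(2,3) \<open>K \<ge> 0\<close>
    by (intro bounded_derivative_imp_lipschitz[where f' = "\<lambda>t. (*) (F' t)"])
      (auto simp: has_field_derivative_def abs_mult mult_right_mono intro: has_derivative_at_withinI
        intro!: onorm_le)
  then have "uniformly_continuous_on {t0<..<T} F"
    by (rule lipschitz_on_uniformly_continuous)
  moreover have "T \<in> closure {t0<..<T}"
    using assms(1) by simp
  ultimately obtain l where "(F \<longlongrightarrow> l) (at T within {t0<..<T})"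
    by (rule uniformly_continuous_on_extension_at_closure)
  moreover have "at T within {t0<..<T} = at_left T"
    using assms(1) by (intro at_within_nhd[of _ "{t0<..}"]) auto
  ultimately show ?thesis
    using that by simp
qed

text \<open>Matching the left limit with \<open>G 0\<close> gives continuity of \<open>H\<close> at
  \<open>T\<close>, but no derivative there. That derivative is supplied afterwards by
  \<open>has_vector_derivative_at_exceptional_point\<close>, once the glued right-hand side is known
  to be continuous.\<close>

lemma glue_at_left_limit:
  fixes F G F' G' :: "real \<Rightarrow> real"
  assumes I: "open I" "I \<subseteq> {..<T}" "open (I \<union> {T..<T + \<epsilon>})"
    and F: "\<And>t. t \<in> I \<Longrightarrow> (F has_real_derivative F' t) (at t)"
    and lim: "(F \<longlongrightarrow> G 0) (at_left T)"
    and G: "continuous_on {0..\<epsilon>} G"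
      "\<And>s. s \<in> {0<..<\<epsilon>} \<Longrightarrow> (G has_real_derivative G' s) (at s)"
  defines "H \<equiv> \<lambda>t. if t < T then F t else G (t - T)"
  shows "continuous_on (I \<union> {T..<T + \<epsilon>}) H"
    and "\<And>t. t \<in> I \<union> {T..<T + \<epsilon>} - {T} \<Longrightarrow>
      (H has_real_derivative (if t < T then F' t else G' (t - T))) (at t)"
proof -
  show H: "(H has_real_derivative (if t < T then F' t else G' (t - T))) (at t)"
    if t: "t \<in> I \<union> {T..<T + \<epsilon>} - {T}" for t
  proof (cases "t < T")
    case True
    then have "t \<in> I" using t by auto
    then have "(H has_real_derivative F' t) (at t)"
      by (intro has_field_derivative_transform_within_open[OF F I(1)]) (use I(2) in \<open>auto simp: H_def\<close>)
    then show ?thesis using True by simp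
  next
    case False
    have "((\<lambda>t. G (t - T)) has_real_derivative G' (t - T) * 1) (at t)"
      using t False I(2)
      by (intro DERIV_chain'[where g = G and f = "\<lambda>t. t - T"] G(2)) (auto intro!: derivative_eq_intros)
    then have "(H has_real_derivative G' (t - T) * 1) (at t)"
      by (rule has_field_derivative_transform_within_open[where S = "{T<..}"])
        (use t False in \<open>auto simp: H_def\<close>)
    then show ?thesis using False by simp
  qed
  show "continuous_on (I \<union> {T..<T + \<epsilon>}) H"
    unfolding continuous_on_eq_continuous_at[OF I(3)]
  proof
    fix t assume t: "t \<in> I \<union> {T..<T + \<epsilon>}"
    show "isCont H t"
    proof (cases "t = T")
      case False
      then show ?thesis using H t DERIV_isCont by blast
    next
      case True
      then have \<epsilon>: "\<epsilon> > 0" using t I(2) by auto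
      have "(H \<longlongrightarrow> G 0) (at_left T)"
        using lim by (rule Lim_transform_eventually) (auto simp: H_def eventually_at_filter)
      moreover have "(H \<longlongrightarrow> G 0) (at_right T)"
      proof -
        have "continuous_on {T..T + \<epsilon>} (\<lambda>t. G (t - T))"
          by (rule continuous_on_compose2[OF G(1)]) (auto intro!: continuous_intros)
        then have "((\<lambda>t. G (t - T)) \<longlongrightarrow> G (T - T)) (at T within {T..T + \<epsilon>})"
          using \<epsilon> unfolding continuous_on by (elim bspec) simp
        then have "((\<lambda>t. G (t - T)) \<longlongrightarrow> G 0) (at_right T)"
          using \<epsilon> by (simp add: at_within_Icc_at_right)
        then show ?thesis
          by (rule Lim_transform_eventually) (auto simp: H_def eventually_at_filter)
      qed
      ultimately have "(H \<longlongrightarrow> G 0) (at T)"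
        by (rule filterlim_split_at)
      then show ?thesis using True by (simp add: isCont_def H_def)
    qed
  qed
qed

text \<open>The hypothesis is gauge integrability, which does not entail absolute integrability. If
  the right-hand side is infinite there is nothing to prove; if it is finite, \<open>d\<close> is
  Lebesgue integrable and both integrals agree. This covers curves whose speed is unbounded near
  exceptional points.\<close>

lemma norm_has_integral_le_nn_integral:
  fixes d :: "real \<Rightarrow> real"
  assumes "(d has_integral I) A"
  shows "ennreal (norm I) \<le> (\<integral>\<^sup>+t\<in>A. ennreal (norm (d t)) \<partial>lborel)"
proof (cases "(\<integral>\<^sup>+t\<in>A. ennreal (norm (d t)) \<partial>lborel) < \<infinity>")
  case True
  have eq: "(\<integral>\<^sup>+t\<in>A. ennreal (norm (d t)) \<partial>lborel) = (\<integral>\<^sup>+t. ennreal (norm (indicator A t *\<^sub>R d t)) \<partial>lebesgue)"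
    unfolding nn_integral_completion by (intro nn_integral_cong) (auto simp: indicator_def)
  have int: "set_integrable lebesgue A d"
    unfolding set_integrable_def
    using has_integral_implies_lebesgue_measurable[OF assms] True eq
    by (intro integrableI_bounded) auto
  have "(LINT t:A|lebesgue. d t) = I"
    using has_integral_unique[OF has_integral_set_lebesgue[OF int] assms] .
  with integral_norm_bound_ennreal[OF int[unfolded set_integrable_def]] eq show ?thesis
    by (simp add: set_lebesgue_integral_def)
next
  case False
  then show ?thesis by (simp add: less_top[symmetric])
qed

lemma has_vector_derivative_componentwise_2:
  fixes x :: "real \<Rightarrow> real ^ 2"
  shows "(x has_vector_derivative v) F \<longleftrightarrow>
    ((\<lambda>t. x t $ 1) has_real_derivative v $ 1) F \<and> ((\<lambda>t. x t $ 2) has_real_derivative v $ 2) F"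
proof safe
  assume x: "(x has_vector_derivative v) F"
  have "((\<lambda>t. x t $ i) has_real_derivative v $ i) F" for i
    using bounded_linear.has_vector_derivative[OF bounded_linear_vec_nth x]
    by (simp add: has_real_derivative_iff_has_vector_derivative)
  then show "((\<lambda>t. x t $ 1) has_real_derivative v $ 1) F"
    "((\<lambda>t. x t $ 2) has_real_derivative v $ 2) F" by blast+
next
  assume "((\<lambda>t. x t $ 1) has_real_derivative v $ 1) F" "((\<lambda>t. x t $ 2) has_real_derivative v $ 2) F"
  then have "((\<lambda>t. x t $ 1 *\<^sub>R axis 1 1) has_vector_derivative v $ 1 *\<^sub>R axis 1 (1::real)) F"
    "((\<lambda>t. x t $ 2 *\<^sub>R axis 2 1) has_vector_derivative v $ 2 *\<^sub>R axis (2::2) (1::real)) F"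
    unfolding has_real_derivative_iff_has_vector_derivative
    by (simp_all only: bounded_linear.has_vector_derivative[OF bounded_linear_scaleR_left])
  from has_vector_derivative_add[OF this]
  have "((\<lambda>t. x t $ 1 *\<^sub>R axis 1 1 + x t $ 2 *\<^sub>R axis 2 1) has_vector_derivative
      v $ 1 *\<^sub>R axis 1 1 + v $ 2 *\<^sub>R (axis 2 1 :: real ^ 2)) F" .
  moreover have "y $ 1 *\<^sub>R axis 1 1 + y $ 2 *\<^sub>R axis 2 1 = y" for y :: "real ^ 2"
    by (simp add: vec_eq_iff forall_2 axis_def)
  ultimately show "(x has_vector_derivative v) F" by simp
qed

subsection \<open>Metrics of revolution\<close>

lemma inner_revolution_metric:
  "v \<bullet> (revolution_metric f p *v v) = (v $ 1)\<^sup>2 + (f (fst p))\<^sup>2 * (v $ 2)\<^sup>2"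
  by (simp add: revolution_metric_def matrix_vector_mult_def inner_vec_def sum_2 power2_eq_square)

lemma matrix_inv_revolution_metric:
  assumes "f (fst p) \<noteq> 0"
  shows "matrix_inv (revolution_metric f p) = vector [vector [1, 0], vector [0, 1 / (f (fst p))\<^sup>2]]"
proof -
  let ?A = "revolution_metric f p" and ?B = "vector [vector [1, 0], vector [0, 1 / (f (fst p))\<^sup>2]] :: real ^ 2 ^ 2"
  have AB: "?A ** ?B = mat 1" "?B ** ?A = mat 1"
    using assms
    by (auto simp: revolution_metric_def matrix_matrix_mult_def mat_def vec_eq_iff forall_2 sum_2)
  \<comment> \<open>\<open>matrix_inv\<close> is defined by choice: the witness \<open>?B\<close>
    shows that the chosen matrix is an inverse, and uniqueness of inverses then identifies it with
    \<open>?B\<close>.\<close>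
  have "?A ** matrix_inv ?A = mat 1 \<and> matrix_inv ?A ** ?A = mat 1"
    unfolding matrix_inv_def by (rule someI[of _ ?B]) (use AB in simp)
  then have inv: "matrix_inv ?A ** ?A = mat 1" ..
  have "matrix_inv ?A = matrix_inv ?A ** (?A ** ?B)"
    by (simp only: AB(1) matrix_mul_rid)
  also have "\<dots> = ?B"
    by (simp only: matrix_mul_assoc inv matrix_mul_lid)
  finally show ?thesis .
qed

lemma fst_cyl_proj [simp]: "fst (cyl_proj x) = x $ 1"
  by (simp add: cyl_proj_def)

context
  fixes f f' :: "real \<Rightarrow> real"
  assumes f: "\<And>r. (f has_real_derivative f' r) (at r)"
    and nz: "\<And>r. f r \<noteq> 0"
begin

lemma partial_deriv_revolution_metric:
  "partial_deriv i (\<lambda>y. revolution_metric f (cyl_proj y) $ j $ l) x =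
    (if i = 1 \<and> j = 2 \<and> l = 2 then 2 * f (x $ 1) * f' (x $ 1) else 0)"
proof -
  have "((\<lambda>y. revolution_metric f (cyl_proj y) $ j $ l) has_derivative
      (\<lambda>h. if j = 2 \<and> l = 2 then 2 * f (x $ 1) * f' (x $ 1) * h $ 1 else 0)) (at x)"
  proof (cases "j = 2 \<and> l = 2")
    case True
    have "((\<lambda>r. (f r)\<^sup>2) has_derivative (\<lambda>h. 2 * f (x $ 1) * f' (x $ 1) * h)) (at (x $ 1))"
      by (auto intro!: derivative_eq_intros f[THEN DERIV_compose_FDERIV]
          f simp: has_field_derivative_def[symmetric])
    from has_derivative_compose[OF bounded_linear_imp_has_derivative[OF bounded_linear_vec_nth] this]
    show ?thesis using True
      by (simp add: revolution_metric_def cyl_proj_def)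
  next
    case False
    then have "(\<lambda>y. revolution_metric f (cyl_proj y) $ j $ l) = (\<lambda>y. if j = l then 1 else 0)"
      using exhaust_2[of j] exhaust_2[of l] by (auto simp: revolution_metric_def)
    then show ?thesis using False by auto
  qed
  then have "frechet_derivative (\<lambda>y. revolution_metric f (cyl_proj y) $ j $ l) (at x) =
      (\<lambda>h. if j = 2 \<and> l = 2 then 2 * f (x $ 1) * f' (x $ 1) * h $ 1 else 0)"
    using frechet_derivative_at by metis
  then show ?thesis
    by (simp add: partial_deriv_def axis_def)
qed

lemma christoffel_revolution_metric:
  "christoffel (revolution_metric f) 1 i j x = (if i = 2 \<and> j = 2 then - f (x $ 1) * f' (x $ 1) else 0)"
  "christoffel (revolution_metric f) 2 i j x = (if i \<noteq> j then f' (x $ 1) / f (x $ 1) else 0)"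
  using exhaust_2[of i] exhaust_2[of j] nz[of "x $ 1"]
  by (auto simp: christoffel_def Let_def partial_deriv_revolution_metric sum_2
      matrix_inv_revolution_metric power2_eq_square)

text \<open>The later arguments see geodesics only through this scalar first-order system for the
  lifted coordinates \<open>r\<close>, \<theta> and their velocities \<open>p\<close>,
  \<open>q\<close>.\<close>

lemma geodesic_on_revolution_metric_iff:
  "geodesic_on (revolution_metric f) I \<gamma> \<longleftrightarrow>
    open I \<and> is_interval I \<and> I \<noteq> {} \<and>
    (\<exists>r \<theta> p q. \<forall>t\<in>I. \<gamma> t = (r t, abs_circle (\<theta> t)) \<and>
      (r has_real_derivative p t) (at t) \<and>
      (\<theta> has_real_derivative q t) (at t) \<and>
      (p has_real_derivative f (r t) * f' (r t) * (q t)\<^sup>2) (at t) \<and>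
      (q has_real_derivative - 2 * f' (r t) / f (r t) * p t * q t) (at t))"
    (is "_ \<longleftrightarrow> _ \<and> _ \<and> _ \<and> (\<exists>r \<theta> p q. \<forall>t\<in>I. ?ode r \<theta> p q t)")
proof -
  have 1: "- (\<Sum>i\<in>UNIV. \<Sum>j\<in>UNIV. christoffel (revolution_metric f) 1 i j x * v $ i * v $ j) =
      f (x $ 1) * f' (x $ 1) * (v $ 2)\<^sup>2" for x v
    by (simp add: christoffel_revolution_metric sum_2 power2_eq_square)
  have 2: "- (\<Sum>i\<in>UNIV. \<Sum>j\<in>UNIV. christoffel (revolution_metric f) 2 i j x * v $ i * v $ j) =
      - 2 * f' (x $ 1) / f (x $ 1) * v $ 1 * v $ 2" for x v
    by (simp add: christoffel_revolution_metric sum_2 field_simps)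
  have eq: "\<gamma> t = cyl_proj (x t) \<and> (x has_vector_derivative v t) (at t) \<and>
      (v has_vector_derivative
        (\<chi> k. - (\<Sum>i\<in>UNIV. \<Sum>j\<in>UNIV.
          christoffel (revolution_metric f) k i j (x t) * v t $ i * v t $ j))) (at t) \<longleftrightarrow>
      ?ode (\<lambda>t. x t $ 1) (\<lambda>t. x t $ 2) (\<lambda>t. v t $ 1) (\<lambda>t. v t $ 2) t" for x v :: "real \<Rightarrow> real ^ 2" and t
    unfolding has_vector_derivative_componentwise_2 vec_lambda_beta 1 2 cyl_proj_def by auto
  have "(\<exists>(x :: real \<Rightarrow> real ^ 2) v :: real \<Rightarrow> real ^ 2. \<forall>t\<in>I. ?ode (\<lambda>t. x t $ 1) (\<lambda>t. x t $ 2) (\<lambda>t. v t $ 1) (\<lambda>t. v t $ 2) t) \<longleftrightarrow>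
      (\<exists>r \<theta> p q. \<forall>t\<in>I. ?ode r \<theta> p q t)" (is "?L \<longleftrightarrow> ?R")
  proof
    assume ?L
    then obtain x v :: "real \<Rightarrow> real ^ 2" where "\<forall>t\<in>I. ?ode (\<lambda>t. x t $ 1) (\<lambda>t. x t $ 2) (\<lambda>t. v t $ 1) (\<lambda>t. v t $ 2) t"
      by (elim exE)
    then show ?R by (intro exI)
  next
    assume ?R
    then obtain r \<theta> p q where "\<forall>t\<in>I. ?ode r \<theta> p q t" by (elim exE)
    then show ?L
      by (intro exI[of _ "\<lambda>t. vector [r t, \<theta> t] :: real ^ 2"] exI[of _ "\<lambda>t. vector [p t, q t] :: real ^ 2"]) simp
  qed
  then show ?thesis
    unfolding geodesic_on_def eq by simp
qed
end

text \<open>The speed of a curve is at least the absolute value of its \<open>r\<close>-velocity,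
  whose integral dominates the total change of \<open>r\<close>. The fundamental theorem of calculus
  is applied in the form that allows the finitely many corners.\<close>

lemma riem_dist_revolution_metric_ge:
  "ennreal \<bar>fst q - fst p\<bar> \<le> riem_dist (revolution_metric f) p q"
  unfolding riem_dist_def
proof (rule INF_greatest)
  fix x
  assume "x \<in> {x. x piecewise_C1_differentiable_on {0..1} \<and> cyl_proj (x 0) = p \<and> cyl_proj (x 1) = q}"
  then have x: "x piecewise_C1_differentiable_on {0..1}" "fst p = x 0 $ 1" "fst q = x 1 $ 1"
    by (auto simp: cyl_proj_def)
  from x(1) obtain S where S: "finite S" "continuous_on {0..1} x" "x C1_differentiable_on {0..1} - S"
    unfolding piecewise_C1_differentiable_on_def by auto
  define d where "d t = vector_derivative x (at t) $ 1" for t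
  have d: "(d has_integral (x 1 $ 1 - x 0 $ 1)) {0..1}"
  proof (rule fundamental_theorem_of_calculus_interior_strong[of S])
    show "continuous_on {0..1} (\<lambda>t. x t $ 1)"
      using S by (intro continuous_intros)
    show "((\<lambda>t. x t $ 1) has_vector_derivative d t) (at t)" if "t \<in> {0<..<1} - S" for t
    proof -
      have "(x has_vector_derivative vector_derivative x (at t)) (at t)"
        using S(3) that by (auto simp: C1_differentiable_on_eq vector_derivative_works)
      then show ?thesis
        unfolding d_def
        by (rule bounded_linear.has_vector_derivative[OF bounded_linear_vec_nth])
    qed
  qed (use S in auto)
  from d have "ennreal \<bar>x 1 $ 1 - x 0 $ 1\<bar> \<le> (\<integral>\<^sup>+t\<in>{0..1}. ennreal \<bar>d t\<bar> \<partial>lborel)"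
    by (rule norm_has_integral_le_nn_integral[simplified])
  also have "\<dots> \<le> curve_length (revolution_metric f) x"
    unfolding curve_length_def Let_def inner_revolution_metric d_def
    by (intro nn_integral_mono mult_right_mono ennreal_leI real_le_rsqrt) auto
  finally show "ennreal \<bar>fst q - fst p\<bar> \<le> curve_length (revolution_metric f) x"
    using x by simp
qed

subsection \<open>The profile and local solutions\<close>

text \<open>The derivative of the profile for \<open>a = - b\<close>. The branches agree at
  \<open>r = 0\<close>, which is where the condition \<open>a + b = 0\<close> enters.\<close>

definition profile' :: "real \<Rightarrow> real \<Rightarrow> real" where
  "profile' b r = (if r \<le> 0 then - b else - b * exp (- b * r))"

context
  fixes b :: real
  assumes b: "b > 0"
begin

private abbreviation (input) "f \<equiv> profile (- b) b"
private abbreviation (input) "f' \<equiv> profile' b"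

lemma profile_pos: "f r > 0"
proof (cases "r \<le> 0")
  case True
  then have "b * r \<le> 0" using b by (simp add: mult_nonneg_nonpos)
  then show ?thesis using True by (simp add: profile_def)
qed (simp add: profile_def)

lemma continuous_profile': "continuous_on A f'"
proof -
  have "f' = (\<lambda>r. - b * exp (- b * max r 0))"
    by (auto simp: profile'_def)
  then show ?thesis by (auto intro!: continuous_intros)
qed

text \<open>Away from the seam this is the derivative of each branch; at the seam it follows from
  continuity of both \<open>f\<close> and \<open>f'\<close>. Writing \<open>f\<close> with
  \<open>max\<close> and \<open>min\<close> makes its continuity evident.\<close>

lemma DERIV_profile: "(f has_real_derivative f' r) (at r)"
  unfolding has_real_derivative_iff_has_vector_derivative
proof (rule has_vector_derivative_at_exceptional_point[where J = UNIV and c = 0])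
  have "f = (\<lambda>r. exp (- b * max r 0) - b * min r 0)"
    by (auto simp: profile_def)
  then show "continuous_on UNIV f" by (auto intro!: continuous_intros)
  show "(f has_vector_derivative f' r) (at r)" if "r \<in> UNIV - {0}" for r
  proof (cases "r < 0")
    case True
    have "((\<lambda>r. 1 + (- b) * r) has_real_derivative f' r) (at r)"
      using True by (auto intro!: derivative_eq_intros simp: profile'_def)
    then show ?thesis
      unfolding has_real_derivative_iff_has_vector_derivative[symmetric]
      by (rule has_field_derivative_transform_within_open[where S = "{..<0}"])
        (use True in \<open>auto simp: profile_def\<close>)
  next
    case False
    have "((\<lambda>r. exp (- b * r)) has_real_derivative f' r) (at r)"
      using False that by (auto intro!: derivative_eq_intros simp: profile'_def)
    then show ?thesis
      unfolding has_real_derivative_iff_has_vector_derivative[symmetric]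
      by (rule has_field_derivative_transform_within_open[where S = "{0<..}"])
        (use False that in \<open>auto simp: profile_def\<close>)
  qed
qed (auto simp: continuous_profile')

text \<open>The lower bounds keep the right-hand sides of the equations bounded up to a finite end
  time. The upper bounds, with \<open>f'\<close> strictly below zero, give a uniform deceleration
  over infinite time.\<close>

lemma profile_bounds:
  assumes "\<bar>r\<bar> \<le> M"
  shows "exp (- b * M) \<le> f r" "f r \<le> 1 + b * M" "- b \<le> f' r" "f' r \<le> - b * exp (- b * M)"
proof -
  have M: "M \<ge> 0" "b * M \<ge> 0" "b * r \<le> b * M" "b * (- r) \<le> b * M"
    using mult_left_mono[of r M b] mult_left_mono[of "- r" M b] assms b by auto
  show "exp (- b * M) \<le> f r"
    using M mult_nonneg_nonpos[of b r] b
    by (auto simp: profile_def intro: order.trans[of _ 1])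
  show "f r \<le> 1 + b * M"
    using M b by (auto simp: profile_def intro: order.trans[of _ 1])
  show "- b \<le> f' r" "f' r \<le> - b * exp (- b * M)"
    using M b by (auto simp: profile'_def)
qed

text \<open>
  On the half \<open>r \<le> 0\<close> the surface is a flat cone with distance \<open>f (r) / b\<close> from its apex, so along a
  geodesic \<open>(f (r))\<^sup>2\<close> is a quadratic polynomial in time.
\<close>
lemma cone_solution:
  assumes "r0 \<le> 0" "r0 < 0 \<or> v0 \<le> 0"
  obtains \<epsilon> \<rho> \<sigma> where "\<epsilon> > 0" "\<rho> 0 = r0" "\<sigma> 0 = v0"
    "\<And>s. s \<in> {0..\<epsilon>} \<Longrightarrow> (\<rho> has_real_derivative \<sigma> s) (at s)"
    "\<And>s. s \<in> {0..\<epsilon>} \<Longrightarrow> (\<sigma> has_real_derivative L\<^sup>2 * f' (\<rho> s) / f (\<rho> s) ^ 3) (at s)"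
proof -
  \<comment> \<open>Here \<open>c\<close> is \<open>f r0\<close>, \<open>A\<close> is
    \<open>b^2\<close> times the squared speed, and \<open>Q\<close> is the polynomial that becomes
    \<open>f^2\<close> along the solution, with initial slope \<open>2 f f' v0\<close>.\<close>
  define c where "c = 1 - b * r0"
  have c: "c \<ge> 1"
    using assms(1) b by (simp add: c_def mult_nonneg_nonpos)
  define A where "A = b\<^sup>2 * (v0\<^sup>2 + (L / c)\<^sup>2)"
  define Q where "Q s = c\<^sup>2 - 2 * b * c * v0 * s + A * s\<^sup>2" for s
  define Q' where "Q' s = - 2 * b * c * v0 + 2 * A * s" for s
  have Q': "(Q has_real_derivative Q' s) (at s)" for s
    unfolding Q_def Q'_def by (auto intro!: derivative_eq_intros)
  have Q'': "(Q' has_real_derivative 2 * A) (at s)" for s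
    unfolding Q'_def by (auto intro!: derivative_eq_intros)
  \<comment> \<open>This is the discriminant of \<open>Q\<close>, constant in \<open>s\<close>; it
    appears as the numerator when \<sigma> is differentiated.\<close>
  have disc: "(Q' s)\<^sup>2 - 4 * A * Q s = - 4 * b\<^sup>2 * L\<^sup>2" for s
    using c unfolding Q_def Q'_def A_def by (simp add: field_simps power2_eq_square)
  define \<rho> where "\<rho> s = (1 - sqrt (Q s)) / b" for s
  define \<sigma> where "\<sigma> s = - Q' s / (2 * b * sqrt (Q s))" for s
  \<comment> \<open>The bound \<open>Q s \<ge> 1\<close> says that the solution stays in the half
    \<rho> \<le> 0. For \<open>r0 < 0\<close> it persists by continuity; on the seam,
    \<open>v0 \<le> 0\<close> makes every term of \<open>Q\<close> push the right way.\<close>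
  have "\<exists>\<epsilon>>0. \<forall>s\<in>{0..\<epsilon>}. Q s \<ge> 1"
  proof (cases "r0 < 0")
    case True
    then have "Q 0 > 1"
      using b by (auto simp: Q_def c_def mult_pos_neg intro!: one_less_power)
    moreover have "isCont Q 0"
      using Q' DERIV_isCont by blast
    ultimately have "eventually (\<lambda>s. Q s > 1) (nhds 0)"
      by (simp add: continuous_within order_tendstoD tendsto_at_iff_tendsto_nhds)
    then obtain d where "d > 0" "\<And>s. dist s 0 < d \<Longrightarrow> Q s > 1"
      unfolding eventually_nhds_metric by blast
    then show ?thesis
      by (intro exI[of _ "d / 2"]) (auto simp: less_imp_le)
  next
    case False
    have "Q s \<ge> 1" if "s \<ge> 0" for s
    proof -
      have "b * c * v0 * s \<le> 0"
        using False assms(2) b c that by (intro mult_nonpos_nonneg mult_nonneg_nonpos) auto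
      moreover have "A * s\<^sup>2 \<ge> 0" "c\<^sup>2 \<ge> 1"
        using c by (auto simp: A_def one_le_power)
      ultimately show ?thesis by (simp add: Q_def)
    qed
    then show ?thesis by (intro exI[of _ 1]) auto
  qed
  then obtain \<epsilon> where \<epsilon>: "\<epsilon> > 0" "\<And>s. s \<in> {0..\<epsilon>} \<Longrightarrow> Q s \<ge> 1" by blast
  show ?thesis
  proof (rule that[of \<epsilon> \<rho> \<sigma>])
    show "\<rho> 0 = r0" "\<sigma> 0 = v0"
      using b c by (simp_all add: \<rho>_def \<sigma>_def Q_def Q'_def) (simp add: c_def)
    fix s assume s: "s \<in> {0..\<epsilon>}"
    then have q: "Q s \<ge> 1" using \<epsilon> by blast
    have sq: "sqrt (Q s) > 0" "sqrt (Q s) * sqrt (Q s) = Q s" using q by auto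
    show "(\<rho> has_real_derivative \<sigma> s) (at s)"
      unfolding \<rho>_def \<sigma>_def using b q
      by (auto intro!: derivative_eq_intros Q' simp: field_simps)
    have "\<rho> s \<le> 0" using b q by (simp add: \<rho>_def divide_nonpos_pos)
    moreover have "1 - b * \<rho> s = sqrt (Q s)"
      using b by (simp add: \<rho>_def)
    ultimately have f: "f (\<rho> s) = sqrt (Q s)" "f' (\<rho> s) = - b"
      by (auto simp: profile_def profile'_def)
    have "(\<sigma> has_real_derivative ((Q' s)\<^sup>2 - 4 * A * Q s) / (4 * b * sqrt (Q s) ^ 3)) (at s)"
      unfolding \<sigma>_def using b q sq
      by (auto intro!: derivative_eq_intros Q' Q'' simp: field_simps power2_eq_square power3_eq_cube)
    also have "((Q' s)\<^sup>2 - 4 * A * Q s) / (4 * b * sqrt (Q s) ^ 3) = L\<^sup>2 * f' (\<rho> s) / f (\<rho> s) ^ 3"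
      using b q unfolding disc f by (simp add: field_simps power2_eq_square)
    finally show "(\<sigma> has_real_derivative L\<^sup>2 * f' (\<rho> s) / f (\<rho> s) ^ 3) (at s)" .
  qed (use \<epsilon> in auto)
qed

text \<open>
  On the half \<open>r \<ge> 0\<close> the surface is a hyperbolic cusp, and \<open>u = f (r)\<close> solves the linear equation
  \<open>u'' = b\<^sup>2 E u\<close>, where \<open>E\<close> is the squared speed.
\<close>
lemma cusp_solution:
  assumes "r0 \<ge> 0" "r0 > 0 \<or> v0 > 0" "v0 \<noteq> 0 \<or> L \<noteq> 0"
  obtains \<epsilon> \<rho> \<sigma> where "\<epsilon> > 0" "\<rho> 0 = r0" "\<sigma> 0 = v0"
    "\<And>s. s \<in> {0..\<epsilon>} \<Longrightarrow> (\<rho> has_real_derivative \<sigma> s) (at s)"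
    "\<And>s. s \<in> {0..\<epsilon>} \<Longrightarrow> (\<sigma> has_real_derivative L\<^sup>2 * f' (\<rho> s) / f (\<rho> s) ^ 3) (at s)"
proof -
  define c where "c = exp (- b * r0)"
  have c: "c > 0" by (simp add: c_def)
  \<comment> \<open>With \<open>E\<close> the squared speed, \<open>k^2 = b^2 E\<close>, and
    \<open>u\<close> is the solution of \<open>u'' = k^2 u\<close> with \<open>u 0 = f r0\<close>
    and \<open>u' 0 = f' v0\<close>. The assumption on \<open>v0\<close> and \<open>L\<close> makes
    \<open>k\<close> positive, so that division by it is legitimate.\<close>
  define k where "k = b * sqrt (v0\<^sup>2 + (L / c)\<^sup>2)"
  have E: "v0\<^sup>2 + (L / c)\<^sup>2 > 0"
    using assms(3) c by (simp add: sum_power2_gt_zero_iff)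
  then have k: "k > 0" "k\<^sup>2 = b\<^sup>2 * (v0\<^sup>2 + (L / c)\<^sup>2)"
    using b by (simp_all add: k_def power_mult_distrib)
  define u where "u s = c * cosh (k * s) - b * v0 * c / k * sinh (k * s)" for s
  define u' where "u' s = c * k * sinh (k * s) - b * v0 * c * cosh (k * s)" for s
  have u': "(u has_real_derivative u' s) (at s)" for s
    unfolding u_def u'_def using k(1) by (auto intro!: derivative_eq_intros simp: field_simps)
  have u'': "(u' has_real_derivative k\<^sup>2 * u s) (at s)" for s
    unfolding u_def u'_def using k(1)
    by (auto intro!: derivative_eq_intros simp: field_simps power2_eq_square)
  \<comment> \<open>Multiplied by \<open>cosh^2 - sinh^2 = 1\<close>, this evaluates the conserved
    quantity \<open>u'^2 - k^2 u^2\<close>, which is the numerator of the derivative of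
    \<sigma>.\<close>
  have "(b\<^sup>2 * v0\<^sup>2 - k\<^sup>2) * c\<^sup>2 = - b\<^sup>2 * L\<^sup>2"
    using c unfolding k(2) by (simp add: field_simps)
  moreover have "(u' s)\<^sup>2 - k\<^sup>2 * (u s)\<^sup>2 =
      (b\<^sup>2 * v0\<^sup>2 - k\<^sup>2) * c\<^sup>2 * ((cosh (k * s))\<^sup>2 - (sinh (k * s))\<^sup>2)" for s
    unfolding u_def u'_def using k(1) by (simp add: field_simps power2_eq_square)
  ultimately have energy: "(u' s)\<^sup>2 - k\<^sup>2 * (u s)\<^sup>2 = - b\<^sup>2 * L\<^sup>2" for s
    by (simp add: cosh_square_eq)
  define \<rho> where "\<rho> s = - ln (u s) / b" for s
  define \<sigma> where "\<sigma> s = - u' s / (b * u s)" for s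
  have u0: "u 0 = c" "u' 0 = - b * v0 * c" by (simp_all add: u_def u'_def)
  have cont: "eventually (\<lambda>s. P (u s)) (nhds 0)" if "open {x. P x}" "P c" for P
    using topological_tendstoD[of u "u 0" "nhds 0" "{x. P x}"] that u'[of 0, THEN DERIV_isCont]
    unfolding isCont_def tendsto_at_iff_tendsto_nhds by (simp add: u0(1))
  \<comment> \<open>The bound \<open>u s \<le> 1\<close> keeps the solution in the half \<rho> \<ge>
    0. On the seam it comes from \<open>v0 > 0\<close>, which makes \<open>u\<close> decrease
    initially.\<close>
  have "\<exists>\<epsilon>>0. \<forall>s\<in>{0..\<epsilon>}. u s \<le> 1"
  proof (cases "r0 > 0")
    case True
    then have "c < 1" using b by (simp add: c_def)
    then have "eventually (\<lambda>s. u s < 1) (nhds 0)"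
      by (intro cont) (auto simp: open_Collect_less)
    then obtain d where "d > 0" "\<And>s. dist s 0 < d \<Longrightarrow> u s < 1"
      unfolding eventually_nhds_metric by blast
    then show ?thesis
      by (intro exI[of _ "d / 2"]) (auto simp: less_imp_le)
  next
    case False
    then have "u' 0 < 0" "u 0 = 1" using assms b c u0 by (auto simp: c_def)
    then obtain d where d: "d > 0" "\<And>h. 0 < h \<Longrightarrow> h < d \<Longrightarrow> u h < 1"
      using DERIV_neg_dec_right[OF u'[of 0]] by auto
    have "u s \<le> 1" if "s \<in> {0..d/2}" for s
      using d(2)[of s] \<open>u 0 = 1\<close> that d(1) by (cases "s = 0") auto
    then show ?thesis using d(1) by (intro exI[of _ "d / 2"]) auto
  qed
  then obtain \<epsilon>1 where \<epsilon>1: "\<epsilon>1 > 0" "\<And>s. s \<in> {0..\<epsilon>1} \<Longrightarrow> u s \<le> 1" by blast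
  have "eventually (\<lambda>s. u s > 0) (nhds 0)"
    using c by (intro cont) (auto simp: open_Collect_less)
  then obtain d where d: "d > 0" "\<And>s. dist s 0 < d \<Longrightarrow> u s > 0"
    unfolding eventually_nhds_metric by blast
  define \<epsilon> where "\<epsilon> = min \<epsilon>1 (d / 2)"
  have \<epsilon>: "\<epsilon> > 0" "\<And>s. s \<in> {0..\<epsilon>} \<Longrightarrow> u s > 0 \<and> u s \<le> 1"
    using \<epsilon>1 d by (auto simp: \<epsilon>_def)
  show ?thesis
  proof (rule that[of \<epsilon> \<rho> \<sigma>])
    show "\<rho> 0 = r0" "\<sigma> 0 = v0"
      using b c by (simp_all add: \<rho>_def \<sigma>_def u0) (simp add: c_def)
    fix s assume s: "s \<in> {0..\<epsilon>}"
    then have q: "u s > 0" "u s \<le> 1" using \<epsilon> by blast+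
    show "(\<rho> has_real_derivative \<sigma> s) (at s)"
      unfolding \<rho>_def \<sigma>_def using b q
      by (auto intro!: derivative_eq_intros u' simp: field_simps)
    have "\<rho> s \<ge> 0" using b q by (simp add: \<rho>_def divide_nonpos_pos ln_le_zero_iff)
    moreover have "exp (- b * \<rho> s) = u s"
      using b q by (simp add: \<rho>_def)
    ultimately have f: "f (\<rho> s) = u s" "f' (\<rho> s) = - b * u s"
      by (cases "\<rho> s = 0"; auto simp: profile_def profile'_def)+
    have "(\<sigma> has_real_derivative ((u' s)\<^sup>2 - k\<^sup>2 * (u s)\<^sup>2) / (b * (u s)\<^sup>2)) (at s)"
      unfolding \<sigma>_def using b q
      by (auto intro!: derivative_eq_intros u' u'' simp: field_simps power2_eq_square)
    also have "((u' s)\<^sup>2 - k\<^sup>2 * (u s)\<^sup>2) / (b * (u s)\<^sup>2) = L\<^sup>2 * f' (\<rho> s) / f (\<rho> s) ^ 3"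
      using b q unfolding energy f by (simp add: field_simps power2_eq_square power3_eq_cube)
    finally show "(\<sigma> has_real_derivative L\<^sup>2 * f' (\<rho> s) / f (\<rho> s) ^ 3) (at s)" .
  qed (use \<epsilon> in auto)
qed

text \<open>
  Only forward solutions are constructed. As \<open>f f' < 0\<close> bends geodesics towards negative \<open>r\<close>, one
  starting on the seam \<open>r = 0\<close> stays in one of the two halves for a short time, and no matching at
  the seam is needed.
\<close>
lemma forward_solution:
  assumes "v0 \<noteq> 0 \<or> L \<noteq> 0"
  obtains \<epsilon> \<rho> \<sigma> where "\<epsilon> > 0" "\<rho> 0 = r0" "\<sigma> 0 = v0"
    "\<And>s. s \<in> {0..\<epsilon>} \<Longrightarrow> (\<rho> has_real_derivative \<sigma> s) (at s)"
    "\<And>s. s \<in> {0..\<epsilon>} \<Longrightarrow> (\<sigma> has_real_derivative L\<^sup>2 * f' (\<rho> s) / f (\<rho> s) ^ 3) (at s)"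
proof (cases "r0 < 0 \<or> r0 = 0 \<and> v0 \<le> 0")
  case True
  then have "r0 \<le> 0" "r0 < 0 \<or> v0 \<le> 0" by auto
  then show ?thesis by (rule cone_solution) (rule that)
next
  case False
  then have "r0 \<ge> 0" "r0 > 0 \<or> v0 > 0" by auto
  then show ?thesis using assms by (rule cusp_solution) (rule that)
qed

subsection \<open>Nontrapping\<close>

text \<open>
  The angular velocity is eliminated by Clairaut's integral \<open>L = (f (r))\<^sup>2 \<theta>'\<close>.
\<close>
lemma extend_reduced_solution:
  fixes r \<theta> p :: "real \<Rightarrow> real"
  assumes I: "open I" "is_interval I" "I \<subseteq> {..<T}" "t0 < T" "{t0<..<T} \<subseteq> I"
    and r: "\<And>t. t \<in> I \<Longrightarrow> (r has_real_derivative p t) (at t)"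
    and \<theta>: "\<And>t. t \<in> I \<Longrightarrow> (\<theta> has_real_derivative L / (f (r t))\<^sup>2) (at t)"
    and p: "\<And>t. t \<in> I \<Longrightarrow> (p has_real_derivative L\<^sup>2 * f' (r t) / f (r t) ^ 3) (at t)"
    and energy: "\<And>t. t \<in> I \<Longrightarrow> (p t)\<^sup>2 + (L / f (r t))\<^sup>2 = E" "E > 0"
    and bd: "\<And>t. t \<in> I \<Longrightarrow> \<bar>r t\<bar> \<le> M"
  obtains J R \<Theta> P where "open J" "is_interval J" "insert T I \<subseteq> J"
    "\<And>t. t \<in> I \<Longrightarrow> R t = r t \<and> \<Theta> t = \<theta> t"
    "\<And>t. t \<in> J \<Longrightarrow> (R has_real_derivative P t) (at t)"
    "\<And>t. t \<in> J \<Longrightarrow> (\<Theta> has_real_derivative L / (f (R t))\<^sup>2) (at t)"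
    "\<And>t. t \<in> J \<Longrightarrow> (P has_real_derivative L\<^sup>2 * f' (R t) / f (R t) ^ 3) (at t)"
proof -
  note pos = profile_pos
  have f_nz [simp]: "f x \<noteq> 0" for x
    using pos[of x] by simp
  have cont_f: "continuous_on A f" for A
    using DERIV_profile by (meson DERIV_isCont continuous_at_imp_continuous_on)
  have cont_f': "continuous_on A f'" for A
    by (rule continuous_profile')
  have I_sub: "t \<in> I" if "t \<in> {t0<..<T}" for t
    using I(5) that by blast
  \<comment> \<open>A positive lower bound for \<open>f\<close> along the solution; with the energy
    bound on \<open>p\<close> it bounds all three derivatives, so \<open>r\<close>, \<theta> and
    \<open>p\<close> have limits at \<open>T\<close>.\<close>
  define m where "m = exp (- b * M)"
  have m: "m > 0" "\<And>t. t \<in> I \<Longrightarrow> m \<le> f (r t)" "\<And>t. t \<in> I \<Longrightarrow> \<bar>f' (r t)\<bar> \<le> b"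
  proof -
    show "m > 0" by (simp add: m_def)
    fix t assume t: "t \<in> I"
    show "m \<le> f (r t)"
      using profile_bounds(1)[OF bd[OF t]] by (simp add: m_def)
    have "f' (r t) \<le> 0" "- b \<le> f' (r t)"
      using b profile_bounds(3)[OF bd[OF t]] by (auto simp: profile'_def)
    then show "\<bar>f' (r t)\<bar> \<le> b" by simp
  qed
  have "\<bar>p t\<bar> \<le> sqrt E" if "t \<in> I" for t
    using energy(1)[OF that] by (metis add_increasing2 order_refl real_sqrt_abs real_sqrt_le_iff zero_le_power2)
  then obtain r0 where r0: "(r \<longlongrightarrow> r0) (at_left T)"
    using bounded_derivative_imp_limit_at_left[OF I(4), of r p "sqrt E"] r I_sub by metis
  have "\<bar>L / (f (r t))\<^sup>2\<bar> \<le> \<bar>L\<bar> / m\<^sup>2" if "t \<in> I" for t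
    using m(1) m(2)[OF that] by (auto simp: abs_divide intro!: divide_left_mono power_mono mult_pos_pos)
  then obtain \<theta>0 where \<theta>0: "(\<theta> \<longlongrightarrow> \<theta>0) (at_left T)"
    using bounded_derivative_imp_limit_at_left[OF I(4), of \<theta> "\<lambda>t. L / (f (r t))\<^sup>2" "\<bar>L\<bar> / m\<^sup>2"] \<theta> I_sub
    by metis
  have "\<bar>L\<^sup>2 * f' (r t) / f (r t) ^ 3\<bar> \<le> L\<^sup>2 * b / m ^ 3" if "t \<in> I" for t
    unfolding abs_divide abs_mult using m(1) m(2,3)[OF that] pos[of "r t"]
    by (auto intro!: frac_le mult_left_mono power_mono)
  then obtain v0 where v0: "(p \<longlongrightarrow> v0) (at_left T)"
    using bounded_derivative_imp_limit_at_left[OF I(4), of p "\<lambda>t. L\<^sup>2 * f' (r t) / f (r t) ^ 3" "L\<^sup>2 * b / m ^ 3"]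
      p I_sub by metis
  \<comment> \<open>The energy passes to the limit: if \<open>L\<close> and \<open>v0\<close> both
    vanished, \<open>E\<close> would be \<open>0\<close>. Hence the limiting data are admissible for
    \<open>forward_solution\<close>.\<close>
  have "v0 \<noteq> 0 \<or> L \<noteq> 0"
  proof (rule ccontr)
    assume "\<not> (v0 \<noteq> 0 \<or> L \<noteq> 0)"
    then have [simp]: "v0 = 0" "L = 0" by auto
    have "((\<lambda>t. (p t)\<^sup>2) \<longlongrightarrow> v0\<^sup>2) (at_left T)"
      using v0 by (intro tendsto_intros)
    moreover have "eventually (\<lambda>t. (p t)\<^sup>2 = E) (at_left T)"
      unfolding eventually_at_left_field using I(4) I_sub energy(1) by auto
    ultimately have "((\<lambda>t. E) \<longlongrightarrow> v0\<^sup>2) (at_left T)"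
      by (rule Lim_transform_eventually)
    then have "E = v0\<^sup>2"
      by (simp add: tendsto_const_iff)
    then show False using energy(2) by simp
  qed
  then obtain \<epsilon> \<rho> \<sigma> where \<epsilon>: "\<epsilon> > 0" and init: "\<rho> 0 = r0" "\<sigma> 0 = v0"
    and \<rho>: "\<And>s. s \<in> {0..\<epsilon>} \<Longrightarrow> (\<rho> has_real_derivative \<sigma> s) (at s)"
    and \<sigma>: "\<And>s. s \<in> {0..\<epsilon>} \<Longrightarrow> (\<sigma> has_real_derivative L\<^sup>2 * f' (\<rho> s) / f (\<rho> s) ^ 3) (at s)"
    using forward_solution[of v0 L r0] by metis
  have cont_\<rho>: "continuous_on {0..\<epsilon>} \<rho>" and cont_\<sigma>: "continuous_on {0..\<epsilon>} \<sigma>"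
    using \<rho> \<sigma> by (meson DERIV_isCont continuous_at_imp_continuous_on)+
  \<comment> \<open>The forward solution determines only \<rho> and \<sigma>; the angle is recovered
    by integrating Clairaut's relation.\<close>
  define w where "w s = L / (f (\<rho> s))\<^sup>2" for s
  have cont_w: "continuous_on {0..\<epsilon>} w"
    unfolding w_def
    by (intro continuous_intros continuous_on_compose2[OF cont_f cont_\<rho>, of UNIV]) auto
  define \<phi> where "\<phi> s = \<theta>0 + integral {0..s} w" for s
  have cont_\<phi>: "continuous_on {0..\<epsilon>} \<phi>"
    unfolding \<phi>_def
    by (intro continuous_intros indefinite_integral_continuous_1 integrable_continuous_real cont_w)
  have \<phi>: "(\<phi> has_real_derivative w s) (at s)" if "s \<in> {0<..<\<epsilon>}" for s
  proof -
    have "((\<lambda>s. \<theta>0 + integral {0..s} w) has_real_derivative 0 + w s) (at s within {0..\<epsilon>})"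
      by (intro DERIV_add DERIV_const integral_has_real_derivative cont_w) (use that in auto)
    moreover have "at s within {0..\<epsilon>} = at s"
      using that by (simp add: at_within_Icc_at)
    ultimately show ?thesis
      unfolding \<phi>_def by simp
  qed

  define J where "J = I \<union> {T..<T + \<epsilon>}"
  have J: "open J" "is_interval J"
  proof -
    \<comment> \<open>Replacing the half-open piece by an open interval that overlaps
      \<open>I\<close> makes openness and connectedness of \<open>J\<close> immediate.\<close>
    have J_eq: "J = I \<union> {t0<..<T + \<epsilon>}"
      using I(3-5) \<epsilon> by (auto simp: J_def)
    then show "open J" using I(1) by auto
    obtain y where y: "y \<in> I" "t0 < y" "y < T"
      using dense[OF I(4)] I(5) by auto
    have "connected (I \<union> {t0<..<T + \<epsilon>})"
      using I(2) y \<epsilon> by (intro connected_Un) (auto simp: is_interval_connected_1)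
    then show "is_interval J"
      by (simp add: J_eq is_interval_connected_1)
  qed
  define R where "R t = (if t < T then r t else \<rho> (t - T))" for t
  define \<Theta> where "\<Theta> t = (if t < T then \<theta> t else \<phi> (t - T))" for t
  define P where "P t = (if t < T then p t else \<sigma> (t - T))" for t
  note glue = glue_at_left_limit[OF I(1,3) J(1)[unfolded J_def], folded J_def]
  have lim: "(r \<longlongrightarrow> \<rho> 0) (at_left T)" "(\<theta> \<longlongrightarrow> \<phi> 0) (at_left T)" "(p \<longlongrightarrow> \<sigma> 0) (at_left T)"
    using r0 \<theta>0 v0 by (simp_all add: init \<phi>_def)
  have sub: "s \<in> {0..\<epsilon>}" if "s \<in> {0<..<\<epsilon>}" for s using that by auto
  note gR = glue[OF r lim(1) cont_\<rho> \<rho>[OF sub], folded R_def]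
  note g\<Theta> = glue[OF \<theta> lim(2) cont_\<phi> \<phi>, folded \<Theta>_def]
  note gP = glue[OF p lim(3) cont_\<sigma> \<sigma>[OF sub], folded P_def]
  have cont_fR: "continuous_on J (\<lambda>t. f (R t))" "continuous_on J (\<lambda>t. f' (R t))"
    using continuous_on_compose2[OF cont_f gR(1), of UNIV] continuous_on_compose2[OF cont_f' gR(1), of UNIV]
    by auto
  \<comment> \<open>Differentiability at the gluing time \<open>T\<close> itself, from continuity of
    the glued function and of its prospective derivative.\<close>
  have ext: "(F has_real_derivative G t) (at t)"
    if "continuous_on J F" "continuous_on J G"
      "\<And>t. t \<in> J - {T} \<Longrightarrow> (F has_real_derivative G t) (at t)" "t \<in> J" for F G :: "real \<Rightarrow> real" and t
    using has_vector_derivative_at_exceptional_point[OF J(1), of F G T t] that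
    by (simp add: has_real_derivative_iff_has_vector_derivative)
  show ?thesis
  proof (rule that[of J R \<Theta> P])
    show "insert T I \<subseteq> J" using \<epsilon> by (auto simp: J_def)
    show "R t = r t \<and> \<Theta> t = \<theta> t" if "t \<in> I" for t
      using that I(3) by (auto simp: R_def \<Theta>_def)
    show "(R has_real_derivative P t) (at t)" if "t \<in> J" for t
      using gR(1) gP(1) _ that
    proof (rule ext)
      show "(R has_real_derivative P t) (at t)" if "t \<in> J - {T}" for t
        unfolding P_def by (rule gR(2)) (use that in auto)
    qed
    show "(\<Theta> has_real_derivative L / (f (R t))\<^sup>2) (at t)" if "t \<in> J" for t
      using g\<Theta>(1) _ _ that
    proof (rule ext)
      show "continuous_on J (\<lambda>t. L / (f (R t))\<^sup>2)"
        by (intro continuous_intros cont_fR) auto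
      show "(\<Theta> has_real_derivative L / (f (R t))\<^sup>2) (at t)" if "t \<in> J - {T}" for t
        using g\<Theta>(2)[of t] that by (auto simp: R_def w_def split: if_splits)
    qed
    show "(P has_real_derivative L\<^sup>2 * f' (R t) / f (R t) ^ 3) (at t)" if "t \<in> J" for t
      using gP(1) _ _ that
    proof (rule ext)
      show "continuous_on J (\<lambda>t. L\<^sup>2 * f' (R t) / f (R t) ^ 3)"
        by (intro continuous_intros cont_fR) auto
      show "(P has_real_derivative L\<^sup>2 * f' (R t) / f (R t) ^ 3) (at t)" if "t \<in> J - {T}" for t
        using gP(2)[of t] that by (auto simp: R_def split: if_splits)
    qed
  qed (use J in auto)
qed

text \<open>Conservation of \<open>E\<close> bounds the radial velocity by \<open>sqrt E\<close>.
  Meridians, with \<open>L = 0\<close>, move at constant nonzero velocity; for the others,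
  confinement of \<open>r\<close> would force a steady deceleration that violates this
  bound.\<close>

lemma unbounded_reduced_solution:
  fixes r p :: "real \<Rightarrow> real"
  assumes r: "\<And>t. t \<ge> t0 \<Longrightarrow> (r has_real_derivative p t) (at t)"
    and p: "\<And>t. t \<ge> t0 \<Longrightarrow> (p has_real_derivative L\<^sup>2 * f' (r t) / f (r t) ^ 3) (at t)"
    and energy: "\<And>t. t \<ge> t0 \<Longrightarrow> (p t)\<^sup>2 + (L / f (r t))\<^sup>2 = E" "E > 0"
  shows "\<exists>t\<ge>t0. \<bar>r t\<bar> > M"
proof (rule ccontr)
  assume "\<not> (\<exists>t\<ge>t0. \<bar>r t\<bar> > M)"
  then have bd: "\<bar>r t\<bar> \<le> M" if "t \<ge> t0" for t
    using that by force
  show False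
  proof (cases "L = 0")
    case True
    have "\<exists>v. \<forall>t\<in>{t0..}. p t = v"
      by (rule has_field_derivative_zero_constant)
        (use p True in \<open>auto intro: has_field_derivative_at_within\<close>)
    then obtain v where v: "\<And>t. t \<ge> t0 \<Longrightarrow> p t = v" by auto
    have "v \<noteq> 0" using energy(1)[of t0] energy(2) True v[of t0] by auto
    have "\<exists>c. \<forall>t\<in>{t0..}. r t - v * t = c"
      by (rule has_field_derivative_zero_constant)
        (use r v in \<open>auto intro!: derivative_eq_intros intro: has_field_derivative_at_within\<close>)
    then obtain c where c: "\<And>t. t \<ge> t0 \<Longrightarrow> r t = c + v * t" by (auto simp: algebra_simps)
    \<comment> \<open>By this time \<open>r\<close> has changed by \<open>2 M + 1\<close>, more than
      the width of the interval from \<open>- M\<close> to \<open>M\<close>.\<close>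
    define t where "t = t0 + (2 * M + 1) / \<bar>v\<bar>"
    have "M \<ge> 0" using bd[of t0] by auto
    then have t: "t \<ge> t0" by (simp add: t_def)
    have "\<bar>r t - r t0\<bar> = \<bar>v\<bar> * (t - t0)"
      using t by (simp add: c abs_mult flip: right_diff_distrib)
    also have "\<dots> = 2 * M + 1" using \<open>v \<noteq> 0\<close> by (simp add: t_def)
    finally show False using bd[OF t] bd[of t0] by linarith
  next
    case False
    \<comment> \<open>The least deceleration compatible with \<open>|r| \<le> M\<close>: smallest
      \<open>- f'\<close> over largest \<open>f^3\<close>.\<close>
    define c where "c = L\<^sup>2 * (b * exp (- b * M)) / (1 + b * M) ^ 3"
    have "M \<ge> 0" using bd[of t0] by auto
    then have c: "c > 0" using False b by (auto simp: c_def intro!: divide_pos_pos mult_pos_pos add_pos_nonneg)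
    have slope: "L\<^sup>2 * f' (r t) / f (r t) ^ 3 \<le> - c" if "t \<ge> t0" for t
    proof -
      have "f' (r t) \<le> 0" using b by (auto simp: profile'_def)
      then have "c \<le> L\<^sup>2 * - f' (r t) / f (r t) ^ 3"
        unfolding c_def using profile_bounds[OF bd[OF that]] profile_pos[of "r t"] b
        by (intro frac_le mult_left_mono power_mono) (auto simp: mult_nonneg_nonpos)
      then show ?thesis by simp
    qed
    \<comment> \<open>By this time \<open>p\<close> has dropped by at least
      \<open>2 sqrt E + 1\<close>, more than its range permits.\<close>
    define t where "t = t0 + (2 * sqrt E + 1) / c"
    have t: "t \<ge> t0" using c energy(2) by (simp add: t_def)
    have p_bd: "\<bar>p t\<bar> \<le> sqrt E" if "t \<ge> t0" for t
      using energy(1)[OF that] by (metis add_increasing2 order_refl real_sqrt_abs real_sqrt_le_iff zero_le_power2)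
    have "p t + c * t \<le> p t0 + c * t0"
    proof (rule DERIV_nonpos_imp_nonincreasing[OF t])
      fix s assume "t0 \<le> s" "s \<le> t"
      then show "\<exists>y. ((\<lambda>s. p s + c * s) has_real_derivative y) (at s) \<and> y \<le> 0"
        using slope[of s] by (intro exI conjI) (auto intro!: derivative_eq_intros p)
    qed
    then have "p t - p t0 \<le> - (c * (t - t0))" by (simp add: algebra_simps)
    also have "\<dots> = - (2 * sqrt E + 1)" using c by (simp add: t_def)
    finally show False using p_bd[OF t] p_bd[of t0] by linarith
  qed
qed

text \<open>The contradiction is obtained at the forward end of \<open>I\<close>, which is why local
  solutions forward in time suffice.\<close>

lemma nontrapping_profile: "nontrapping (revolution_metric f)"
  unfolding nontrapping_def
proof safe
  let ?g = "revolution_metric f"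
  fix I \<gamma>
  assume max: "maximal_geodesic_on ?g I \<gamma>" and nonconst: "\<not> \<gamma> constant_on I"
    and "riem_bounded ?g (\<gamma> ` I)"
  note nz = profile_pos[THEN less_imp_neq, symmetric]
  note iff = geodesic_on_revolution_metric_iff[OF DERIV_profile nz]
  from max have "geodesic_on ?g I \<gamma>" by (simp only: maximal_geodesic_on_def)
  then obtain r \<theta> p q where I: "open I" "is_interval I" "I \<noteq> {}"
    and ode: "\<forall>t\<in>I. \<gamma> t = (r t, abs_circle (\<theta> t)) \<and>
      (r has_real_derivative p t) (at t) \<and>
      (\<theta> has_real_derivative q t) (at t) \<and>
      (p has_real_derivative f (r t) * f' (r t) * (q t)\<^sup>2) (at t) \<and>
      (q has_real_derivative - 2 * f' (r t) / f (r t) * p t * q t) (at t)"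
    unfolding iff by (elim conjE exE)
  have \<gamma>: "\<gamma> t = (r t, abs_circle (\<theta> t))"
    and r: "(r has_real_derivative p t) (at t)"
    and \<theta>: "(\<theta> has_real_derivative q t) (at t)"
    and p: "(p has_real_derivative f (r t) * f' (r t) * (q t)\<^sup>2) (at t)"
    and q: "(q has_real_derivative - 2 * f' (r t) / f (r t) * p t * q t) (at t)"
    if "t \<in> I" for t
    using bspec[OF ode that] by simp_all
  have "convex I" using I(2) is_interval_convex by blast
  have fr: "((\<lambda>t. f (r t)) has_real_derivative f' (r t) * p t) (at t)" if "t \<in> I" for t
    using DERIV_chain2[OF DERIV_profile r[OF that]] .
  \<comment> \<open>Clairaut's integral, conserved because the coefficients do not depend on the
    angle.\<close>
  have "\<exists>L. \<forall>t\<in>I. (f (r t))\<^sup>2 * q t = L"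
    using \<open>convex I\<close>
  proof (rule has_field_derivative_zero_constant)
    fix t assume t: "t \<in> I"
    have "((\<lambda>t. (f (r t))\<^sup>2 * q t) has_real_derivative 0) (at t)"
      by (rule derivative_eq_intros fr[OF t] q[OF t] refl)+ (use nz[of "r t"] in \<open>simp add: field_simps power2_eq_square\<close>)
    then show "((\<lambda>t. (f (r t))\<^sup>2 * q t) has_real_derivative 0) (at t within I)"
      by (rule has_field_derivative_at_within)
  qed
  then obtain L where "\<And>t. t \<in> I \<Longrightarrow> (f (r t))\<^sup>2 * q t = L" by blast
  then have L: "q t = L / (f (r t))\<^sup>2" if "t \<in> I" for t
    using that nz[of "r t"] by (auto simp: field_simps)
  have p': "(p has_real_derivative L\<^sup>2 * f' (r t) / f (r t) ^ 3) (at t)" if "t \<in> I" for t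
    using p[OF that] nz[of "r t"] unfolding L[OF that]
    by (simp add: field_simps power2_eq_square power3_eq_cube)
  have \<theta>': "(\<theta> has_real_derivative L / (f (r t))\<^sup>2) (at t)" if "t \<in> I" for t
    using \<theta>[OF that] L[OF that] by simp
  have "\<exists>E. \<forall>t\<in>I. (p t)\<^sup>2 + (L / f (r t))\<^sup>2 = E"
    using \<open>convex I\<close>
  proof (rule has_field_derivative_zero_constant)
    fix t assume t: "t \<in> I"
    have "((\<lambda>t. (p t)\<^sup>2 + (L / f (r t))\<^sup>2) has_real_derivative 0) (at t)"
      by (rule derivative_eq_intros fr[OF t] p'[OF t] refl nz)+
        (use nz[of "r t"] in \<open>simp add: field_simps power2_eq_square power3_eq_cube\<close>)
    then show "((\<lambda>t. (p t)\<^sup>2 + (L / f (r t))\<^sup>2) has_real_derivative 0) (at t within I)"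
      by (rule has_field_derivative_at_within)
  qed
  then obtain E where E: "\<And>t. t \<in> I \<Longrightarrow> (p t)\<^sup>2 + (L / f (r t))\<^sup>2 = E" by blast
  \<comment> \<open>This is where nonconstancy enters: zero energy would make \<open>p\<close> and
    \<open>L\<close> vanish, and so fix both coordinates.\<close>
  have "E > 0"
  proof (rule ccontr)
    assume "\<not> E > 0"
    have zero: "p t = 0 \<and> L = 0" if "t \<in> I" for t
      using E[OF that] \<open>\<not> E > 0\<close> nz[of "r t"]
      by (auto simp: not_less sum_power2_le_zero_iff)
    have "\<exists>c. \<forall>t\<in>I. r t = c" "\<exists>c. \<forall>t\<in>I. \<theta> t = c"
      using \<open>convex I\<close> r \<theta>' zero
      by (intro has_field_derivative_zero_constant; force intro: has_field_derivative_at_within)+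
    then have "\<gamma> constant_on I"
      using \<gamma> unfolding constant_on_def by metis
    then show False using nonconst by contradiction
  qed
  obtain M where bd: "\<And>t. t \<in> I \<Longrightarrow> \<bar>r t\<bar> \<le> M"
  proof -
    from \<open>riem_bounded ?g (\<gamma> ` I)\<close> obtain x C where
      "\<And>t. t \<in> I \<Longrightarrow> riem_dist ?g x (\<gamma> t) \<le> ennreal C"
      unfolding riem_bounded_def by blast
    then have "ennreal \<bar>fst (\<gamma> t) - fst x\<bar> \<le> ennreal C" if "t \<in> I" for t
      using that riem_dist_revolution_metric_ge order.trans by blast
    then have "\<bar>r t - fst x\<bar> \<le> max 0 C" if "t \<in> I" for t
      using that \<gamma>[OF that] by (metis ennreal_le_iff2 fst_conv max.coboundedI1 max.coboundedI2)
    then show ?thesis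
      by (intro that[of "max 0 C + \<bar>fst x\<bar>"]) (smt (verit))
  qed
  obtain t0 where t0: "t0 \<in> I" using I(3) by blast
  show False
  proof (cases "bdd_above I")
    case True
    define T where "T = Sup I"
    have le: "t \<le> T" if "t \<in> I" for t
      unfolding T_def using cSup_upper[OF that True] .
    have T: "I \<subseteq> {..<T}"
    proof
      fix t assume "t \<in> I"
      then obtain e where "e > 0" "ball t e \<subseteq> I" using I(1) open_contains_ball by blast
      then have "t + e / 2 \<in> I" by (auto simp: dist_real_def)
      with le[of "t + e / 2"] \<open>e > 0\<close> show "t \<in> {..<T}" by simp
    qed
    then have "t0 < T" using t0 by auto
    have "{t0<..<T} \<subseteq> I"
    proof
      fix t assume t: "t \<in> {t0<..<T}"
      then obtain u where "u \<in> I" "t < u"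
        using less_cSup_iff[OF I(3) True, of t] by (auto simp: T_def)
      then show "t \<in> I" using I(2) t t0 mem_is_interval_1_I[of I t0 u t] by auto
    qed
    from extend_reduced_solution[OF I(1,2) T \<open>t0 < T\<close> this r \<theta>' p' E \<open>E > 0\<close> bd]
    obtain J R \<Theta> P where J: "open J" "is_interval J" "insert T I \<subseteq> J"
      and eq: "\<And>t. t \<in> I \<Longrightarrow> R t = r t \<and> \<Theta> t = \<theta> t"
      and R: "\<And>t. t \<in> J \<Longrightarrow> (R has_real_derivative P t) (at t)"
      and \<Theta>: "\<And>t. t \<in> J \<Longrightarrow> (\<Theta> has_real_derivative L / (f (R t))\<^sup>2) (at t)"
      and P: "\<And>t. t \<in> J \<Longrightarrow> (P has_real_derivative L\<^sup>2 * f' (R t) / f (R t) ^ 3) (at t)"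
      by metis
    define \<delta> where "\<delta> t = (R t, abs_circle (\<Theta> t))" for t
    \<comment> \<open>Clairaut's relation reinstates the angular velocity; differentiating it gives
      back the second geodesic equation.\<close>
    define Q where "Q t = L / (f (R t))\<^sup>2" for t
    have "geodesic_on ?g J \<delta>"
      unfolding iff
    proof (intro conjI exI ballI)
      fix t assume t: "t \<in> J"
      show "\<delta> t = (R t, abs_circle (\<Theta> t))" by (simp add: \<delta>_def)
      show "(R has_real_derivative P t) (at t)" "(\<Theta> has_real_derivative Q t) (at t)"
        using R \<Theta> t by (auto simp: Q_def)
      show "(P has_real_derivative f (R t) * f' (R t) * (Q t)\<^sup>2) (at t)"
        using P[OF t] nz[of "R t"] by (simp add: Q_def field_simps power2_eq_square power3_eq_cube)
      have "((\<lambda>t. f (R t)) has_real_derivative f' (R t) * P t) (at t)"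
        using DERIV_chain2[OF DERIV_profile R[OF t]] .
      then show "(Q has_real_derivative - 2 * f' (R t) / f (R t) * P t * Q t) (at t)"
        unfolding Q_def using nz[of "R t"]
        by (auto intro!: derivative_eq_intros simp: field_simps power2_eq_square)
    qed (use J in auto)
    moreover have "\<forall>t\<in>I. \<delta> t = \<gamma> t"
      using eq \<gamma> by (simp add: \<delta>_def)
    ultimately have "J = I"
      using max J(3) unfolding maximal_geodesic_on_def by blast
    then show False using J(3) T by auto
  next
    case False
    have sub: "t \<in> I" if "t \<ge> t0" for t
    proof -
      obtain u where "u \<in> I" "t < u"
        using False unfolding bdd_above_def by (meson not_le)
      then show ?thesis using I(2) that t0 mem_is_interval_1_I[of I t0 u t] by auto
    qed
    obtain t where "t \<ge> t0" "\<bar>r t\<bar> > M"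
      using unbounded_reduced_solution[of t0 r p L E M] r p' E \<open>E > 0\<close> sub by blast
    then show False using bd[of t] sub by force
  qed
qed

end

theorem lemma2p1:
  fixes a b :: real
  assumes "a < 0" and "0 < b" and "a + b = 0"
  shows "nontrapping (revolution_metric (profile a b))"
proof -
  have "a = - b" using assms(3) by simp
  then show ?thesis using nontrapping_profile[OF assms(2)] by simp
qed

end
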